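(* Let $N\ge 1$ and let $a_j<b_j$ be real numbers for $j=1,\dots,N$. Then for any $\xi,\eta\in\prod_{j=1}^N(a_j,b_j)$, $$\delta_\Psi^2(\xi,\eta)\;\le\;\sum_{j=1}^N\left(\frac{\eta_j-\xi_j}{b_j-a_j}\right)\bigl(\phi_j(\eta_j)-\phi_j(\xi_j)\bigr),\qquad\text{where}\quad \phi_j(x)=\ln\left(\frac{x-a_j}{b_j-x}\right),\ x\in(a_j,b_j).$$
   Context: Put $D_j=b_j-a_j$, $\Omega=\prod_{j=1}^N[a_j,b_j]$ and define, with the convention $0\ln 0=0$, $$\Psi(\xi)=\sum_{j=1}^N\left[\frac{\xi_j-a_j}{D_j}\ln\left(\frac{\xi_j-a_j}{D_j}\right)+\frac{b_j-\xi_j}{D_j}\ln\left(\frac{b_j-\xi_j}{D_j}\right)\right],\qquad \xi\in\Omega .$$ The Bregman divergence associated with $\Psi$ is $$\delta_\Psi^2(\xi,\eta)=\Psi(\xi)-\Psi(\eta)-\langle \xi-\eta,\nabla\Psi(\eta)\rangle ,$$ for $\xi\in\Omega$ and $\eta$ in the interior of $\Omega$. The superscript $2$ in $\delta_\Psi^2$ is part of the notation. *)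

theory Defs
  imports "HOL-Analysis.Analysis"
begin

text \<open>
  Vectors with \<open>N\<close> real components are elements of \<^typ>\<open>real ^ 'n\<close>; the finite index type
  \<open>'n\<close> is arbitrary and nonempty, which accounts for \<open>N \<ge> 1\<close>.
\<close>

text \<open>
  As a total function, \<open>ln\<close> has some real value at \<open>0\<close>, so \<open>0 * ln 0 = 0\<close> holds
  by \<open>0 * x = 0\<close>, in agreement with the usual convention on the boundary of the box.
  Values outside \<open>cbox a b\<close> carry no meaning.
\<close>

definition Psi :: "real ^ 'n \<Rightarrow> real ^ 'n \<Rightarrow> real ^ 'n \<Rightarrow> real" where
  "Psi a b \<xi> =
    (\<Sum>j\<in>UNIV. (\<xi> $ j - a $ j) / (b $ j - a $ j) * ln ((\<xi> $ j - a $ j) / (b $ j - a $ j))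
            + (b $ j - \<xi> $ j) / (b $ j - a $ j) * ln ((b $ j - \<xi> $ j) / (b $ j - a $ j)))"

definition gradient :: "('v::real_inner \<Rightarrow> real) \<Rightarrow> 'v \<Rightarrow> 'v" where
  "gradient F x = (THE D. GDERIV F x :> D)"

lemma gradient_eqI:
  assumes "GDERIV F x :> D"
  shows "gradient F x = D"
  unfolding gradient_def
proof (rule the_equality)
  fix E assume "GDERIV F x :> E"
  with assms have "(\<lambda>h. h \<bullet> E) = (\<lambda>h. h \<bullet> D)"
    unfolding gderiv_def by (rule has_derivative_unique[rotated])
  then show "E = D"
    by (metis inner_commute vector_eq_ldot)
qed (rule assms)

text \<open>
  The gradient is two-sided, so \<open>\<eta>\<close> has to be an interior point of the domain of \<open>F\<close>.
\<close>

definition bregman :: "('v::real_inner \<Rightarrow> real) \<Rightarrow> 'v \<Rightarrow> 'v \<Rightarrow> real" where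
  "bregman F \<xi> \<eta> = F \<xi> - F \<eta> - (\<xi> - \<eta>) \<bullet> gradient F \<eta>"

definition phi :: "real ^ 'n \<Rightarrow> real ^ 'n \<Rightarrow> 'n \<Rightarrow> real \<Rightarrow> real" where
  "phi a b j x = ln ((x - a $ j) / (b $ j - x))"

end

theory Submission
  imports Defs
begin

text \<open>
  Adding a Bregman divergence to the one with its arguments exchanged cancels all values of
  the potential and leaves
  \<open>\<delta>(\<xi>, \<eta>) + \<delta>(\<eta>, \<xi>) = \<langle>\<eta> - \<xi>, \<nabla>\<Psi>(\<eta>) - \<nabla>\<Psi>(\<xi>)\<rangle>\<close>.
  Since the \<open>j\<close>-th component of \<open>\<nabla>\<Psi>\<close> is \<open>\<phi>\<^sub>j / (b\<^sub>j - a\<^sub>j)\<close> (lemma \<open>gradient_Psi\<close>), the inner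
  product is exactly the asserted upper bound, and what has to be seen is that the exchanged
  divergence \<open>\<delta>(\<eta>, \<xi>)\<close> is nonnegative (lemma \<open>bregman_Psi_nonneg\<close>).

  Nonnegativity is the convexity of \<open>\<Psi>\<close>, and for this potential it has a direct proof. In
  the normalised coordinates \<open>p = (\<xi>\<^sub>j - a\<^sub>j) / (b\<^sub>j - a\<^sub>j)\<close> and \<open>q = (\<eta>\<^sub>j - a\<^sub>j) / (b\<^sub>j - a\<^sub>j)\<close> the
  \<open>j\<close>-th summand of \<open>\<Psi>\<close> is the negative entropy of the distribution \<open>(p, 1 - p)\<close>, and its
  contribution to \<open>\<delta>(\<eta>, \<xi>)\<close> is the relative entropy of \<open>(q, 1 - q)\<close> with respect to
  \<open>(p, 1 - p)\<close>, which is nonnegative by Gibbs' inequality.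
\<close>

lemma bregman_add_swap:
  "bregman F x y + bregman F y x = (y - x) \<bullet> (gradient F y - gradient F x)"
  by (simp add: bregman_def inner_diff_left inner_diff_right)

text \<open>
  The derivative of \<open>t ln t\<close> is \<open>ln t + 1\<close>. Since the two arguments move in opposite
  directions, the constants cancel, which is why only the log-odds ratio remains.
\<close>

lemma has_real_derivative_neg_entropy:
  fixes a b x :: real
  assumes "a < x" "x < b"
  shows "((\<lambda>x. (x - a) / (b - a) * ln ((x - a) / (b - a))
             + (b - x) / (b - a) * ln ((b - x) / (b - a)))
          has_real_derivative ln ((x - a) / (b - x)) / (b - a)) (at x)"
proof -
  have mult_ln_self: "((\<lambda>x. u x * ln (u x)) has_real_derivative u' * (ln (u x) + 1)) (at x)"
    if "(u has_real_derivative u') (at x)" "0 < u x" for u :: "real \<Rightarrow> real" and u'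
    using that by (auto intro!: derivative_eq_intros simp: algebra_simps)
  have lower: "((\<lambda>x. (x - a) / (b - a) * ln ((x - a) / (b - a)))
      has_real_derivative 1 / (b - a) * (ln ((x - a) / (b - a)) + 1)) (at x)"
    using assms by (intro mult_ln_self) (auto intro!: derivative_eq_intros)
  have upper: "((\<lambda>x. (b - x) / (b - a) * ln ((b - x) / (b - a)))
      has_real_derivative - 1 / (b - a) * (ln ((b - x) / (b - a)) + 1)) (at x)"
    using assms by (intro mult_ln_self DERIV_cdivide) (auto intro!: derivative_eq_intros)
  have slope: "1 / (b - a) * (ln ((x - a) / (b - a)) + 1)
      + - 1 / (b - a) * (ln ((b - x) / (b - a)) + 1) = ln ((x - a) / (b - x)) / (b - a)"
    using assms by (simp add: ln_div diff_divide_distrib[symmetric])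
  show ?thesis
    using DERIV_add[OF lower upper] unfolding slope .
qed

lemma gradient_Psi:
  fixes a b \<eta> :: "real ^ 'n"
  assumes "\<eta> \<in> box a b"
  shows "gradient (Psi a b) \<eta> = (\<chi> j. phi a b j (\<eta> $ j) / (b $ j - a $ j))"
proof (rule gradient_eqI)
  let ?g = "\<lambda>j x. (x - a $ j) / (b $ j - a $ j) * ln ((x - a $ j) / (b $ j - a $ j))
                 + (b $ j - x) / (b $ j - a $ j) * ln ((b $ j - x) / (b $ j - a $ j))"
  have "((\<lambda>\<xi>. ?g j (\<xi> $ j)) has_derivative
         (\<lambda>h. phi a b j (\<eta> $ j) / (b $ j - a $ j) * h $ j)) (at \<eta>)" for j
  proof -
    have "((\<lambda>\<xi>. \<xi> $ j) has_derivative (\<lambda>h. h $ j)) (at \<eta>)"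
      by (rule bounded_linear_imp_has_derivative[OF bounded_linear_vec_nth])
    moreover have "(?g j has_derivative (*) (phi a b j (\<eta> $ j) / (b $ j - a $ j))) (at (\<eta> $ j))"
      using has_real_derivative_neg_entropy[of "a $ j" "\<eta> $ j" "b $ j"] assms
      unfolding phi_def has_field_derivative_def by (simp add: mem_box_cart)
    ultimately show ?thesis
      by (rule has_derivative_compose)
  qed
  then have "((\<lambda>\<xi>. \<Sum>j\<in>UNIV. ?g j (\<xi> $ j)) has_derivative
         (\<lambda>h. \<Sum>j\<in>UNIV. phi a b j (\<eta> $ j) / (b $ j - a $ j) * h $ j)) (at \<eta>)"
    by (intro has_derivative_sum) auto
  then show "GDERIV (Psi a b) \<eta> :> (\<chi> j. phi a b j (\<eta> $ j) / (b $ j - a $ j))"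
    unfolding gderiv_def Psi_def inner_vec_def by (simp add: mult.commute)
qed

text \<open>
  This is \<open>ln t \<le> t - 1\<close> at \<open>t = p / q\<close>, arranged so that the lower bounds for \<open>(p, q)\<close>
  and \<open>(1 - p, 1 - q)\<close> add up to zero; adding the two instances gives Gibbs' inequality
  for distributions on two points.
\<close>

lemma diff_le_mult_ln_diff:
  fixes p q :: real
  assumes "0 < p" "0 < q"
  shows "q - p \<le> q * (ln q - ln p)"
proof -
  have "q * ln (p / q) \<le> q * (p / q - 1)"
    using assms by (intro mult_left_mono ln_le_minus_one) auto
  then show ?thesis
    using assms by (simp add: ln_div algebra_simps)
qed

text \<open>
  With \<open>p\<close> and \<open>q\<close> the normalised positions of \<open>x\<close> and \<open>y\<close>, the gap between the two sides is
  the relative entropy \<open>q ln (q / p) + (1 - q) ln ((1 - q) / (1 - p))\<close>.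
\<close>

lemma neg_entropy_above_tangent:
  fixes a b x y :: real
  assumes "a < x" "x < b" "a < y" "y < b"
  shows "(y - x) * (ln ((x - a) / (b - x)) / (b - a))
    \<le> ((y - a) / (b - a) * ln ((y - a) / (b - a)) + (b - y) / (b - a) * ln ((b - y) / (b - a)))
     - ((x - a) / (b - a) * ln ((x - a) / (b - a)) + (b - x) / (b - a) * ln ((b - x) / (b - a)))"
proof -
  define p q where "p = (x - a) / (b - a)" and "q = (y - a) / (b - a)"
  have pq: "0 < p" "p < 1" "0 < q" "q < 1"
    using assms by (auto simp: p_def q_def)
  have "p + (b - x) / (b - a) = 1" "q + (b - y) / (b - a) = 1"
    using assms by (simp_all add: p_def q_def add_divide_distrib[symmetric])
  then have compl: "(b - x) / (b - a) = 1 - p" "(b - y) / (b - a) = 1 - q"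
    by simp_all
  have "(x - a) / (b - x) = p / (1 - p)"
    unfolding compl(1)[symmetric] unfolding p_def using assms by simp
  then have "ln ((x - a) / (b - x)) = ln p - ln (1 - p)"
    using pq by (simp add: ln_div)
  moreover have "(y - x) / (b - a) = q - p"
    by (simp add: p_def q_def diff_divide_distrib)
  ultimately have slope: "(y - x) * (ln ((x - a) / (b - x)) / (b - a)) = (q - p) * (ln p - ln (1 - p))"
    by (metis times_divide_eq_left times_divide_eq_right)
  have "(q - p) * (ln p - ln (1 - p))
      \<le> (q * ln q + (1 - q) * ln (1 - q)) - (p * ln p + (1 - p) * ln (1 - p))"
    using diff_le_mult_ln_diff[of p q] diff_le_mult_ln_diff[of "1 - p" "1 - q"] pq
    by (simp add: algebra_simps)
  then show ?thesis
    unfolding slope compl p_def[symmetric] q_def[symmetric] .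
qed

lemma bregman_Psi_nonneg:
  fixes a b \<xi> \<eta> :: "real ^ 'n"
  assumes "\<xi> \<in> box a b" "\<eta> \<in> box a b"
  shows "0 \<le> bregman (Psi a b) \<eta> \<xi>"
proof -
  have "(\<eta> - \<xi>) \<bullet> gradient (Psi a b) \<xi>
      = (\<Sum>j\<in>UNIV. (\<eta> $ j - \<xi> $ j) * (phi a b j (\<xi> $ j) / (b $ j - a $ j)))"
    by (simp add: gradient_Psi[OF assms(1)] inner_vec_def)
  also have "\<dots> \<le> Psi a b \<eta> - Psi a b \<xi>"
    unfolding Psi_def phi_def sum_subtractf[symmetric]
    using assms by (intro sum_mono neg_entropy_above_tangent) (auto simp: mem_box_cart)
  finally show ?thesis
    by (simp add: bregman_def)
qed

theorem theorem2p3: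
  fixes a b \<xi> \<eta> :: "real ^ 'n"
  assumes "\<And>j. a $ j < b $ j"
    and "\<xi> \<in> box a b" and "\<eta> \<in> box a b"
  shows "bregman (Psi a b) \<xi> \<eta>
    \<le> (\<Sum>j\<in>UNIV. (\<eta> $ j - \<xi> $ j) / (b $ j - a $ j) * (phi a b j (\<eta> $ j) - phi a b j (\<xi> $ j)))"
proof -
  have "bregman (Psi a b) \<xi> \<eta> \<le> bregman (Psi a b) \<xi> \<eta> + bregman (Psi a b) \<eta> \<xi>"
    using bregman_Psi_nonneg[OF assms(2,3)] by simp
  also have "\<dots> = (\<eta> - \<xi>) \<bullet> (gradient (Psi a b) \<eta> - gradient (Psi a b) \<xi>)"
    by (rule bregman_add_swap)
  also have "\<dots> = (\<Sum>j\<in>UNIV. (\<eta> $ j - \<xi> $ j) / (b $ j - a $ j)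
      * (phi a b j (\<eta> $ j) - phi a b j (\<xi> $ j)))"
    by (simp add: gradient_Psi[OF assms(2)] gradient_Psi[OF assms(3)] inner_vec_def
        diff_divide_distrib[symmetric])
  finally show ?thesis .
qed

end
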